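(* If $p_n(\mathfrak{2D},k)$ is the number of binary partitions of $k$ into distinct non-negative powers of two no greater than $2^n$ (that is, partitions of $k$ into distinct parts from $\{2^0,2^1,\dots,2^n\}$), then $$(1+q^1)(1+q^2)(1+q^4)\cdots(1+q^{2^n})=\frac{1-q^{2^{n+1}}}{1-q}=\sum_{k=0}^{2^{n+1}-1}p_n(\mathfrak{2D},k)q^k$$ $$=\cfrac{1}{1-\cfrac{q^1}{1+q^1-\cfrac{(1+q^1)q^2}{q^1+q^2+q^1q^2-\cfrac{(1+q^2)q^4}{q^2+q^4+q^2q^4-\ddots-\cfrac{(1+q^{2^{n-1}})q^{2^n}}{q^{2^{n-1}}+q^{2^n}+q^{2^{n-1}}q^{2^n}}}}}}.$$
   Formalization: The printed continued fraction is false for n=2, q=2 (285/11 instead of 255); for j≥2 the numerator (1+q^{2^{j-1}})q^{2^j} is corrected to q^{2^{j-2}}(1+q^{2^{j-1}})q^{2^j}; quotient and fraction are claimed where no denominator vanishes. *)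

theory Defs
  imports "HOL-Computational_Algebra.Computational_Algebra" "HOL-Library.Multiset"
begin

text \<open>Partitions are multisets of parts; multiplicity at most one means distinct parts.\<close>

definition distinct_binary_partitions :: "nat \<Rightarrow> nat \<Rightarrow> nat multiset set" where
  "distinct_binary_partitions n k =
     {M. set_mset M \<subseteq> {2 ^ i |i. i \<le> n} \<and> (\<forall>x. count M x \<le> 1) \<and> sum_mset M = k}"

definition p2D :: "nat \<Rightarrow> nat \<Rightarrow> nat" where
  "p2D n k = card (distinct_binary_partitions n k)"

text \<open>
  A list \<open>[(a\<^sub>0, b\<^sub>0), \<dots>, (a\<^sub>m, b\<^sub>m)]\<close> stands for the finite continued fraction
  \<open>a\<^sub>0 / (b\<^sub>0 - a\<^sub>1 / (b\<^sub>1 - \<dots> - a\<^sub>m / b\<^sub>m))\<close>, with minus signs throughout.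
\<close>

fun cfrac :: "('a::field \<times> 'a) list \<Rightarrow> 'a" where
  "cfrac [] = 0"
| "cfrac ((a, b) # xs) = a / (b - cfrac xs)"

text \<open>
  Since \<open>x / 0 = 0\<close> in a field of HOL, whether a continued fraction makes sense has to be
  recorded separately: none of the divisions performed in it is by zero.
\<close>

fun cfrac_defined :: "('a::field \<times> 'a) list \<Rightarrow> bool" where
  "cfrac_defined [] \<longleftrightarrow> True"
| "cfrac_defined ((a, b) # xs) \<longleftrightarrow> b - cfrac xs \<noteq> 0 \<and> cfrac_defined xs"

text \<open>
  With \<open>u\<^sub>i = q ^ (2 ^ i)\<close>, the levels of the continued fraction are
  \<open>(1, 1)\<close>, \<open>(u\<^sub>0, 1 + u\<^sub>0)\<close>, \<open>((1 + u\<^sub>0) u\<^sub>1, u\<^sub>0 + u\<^sub>1 + u\<^sub>0 u\<^sub>1)\<close> and then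
  \<open>(u\<^sub>i (1 + u\<^bsub>i+1\<^esub>) u\<^bsub>i+2\<^esub>, u\<^bsub>i+1\<^esub> + u\<^bsub>i+2\<^esub> + u\<^bsub>i+1\<^esub> u\<^bsub>i+2\<^esub>)\<close> for \<open>i = 0, 1, \<dots>\<close>.
  This is Euler's continued fraction for \<open>1 + u\<^sub>0 + (1 + u\<^sub>0) u\<^sub>1 + (1 + u\<^sub>0) (1 + u\<^sub>1) u\<^sub>2 + \<dots>\<close>,
  cleared of denominators. Multiplying the level with \<open>u\<^bsub>i+1\<^esub>\<close> and \<open>u\<^bsub>i+2\<^esub>\<close> in the denominator
  by \<open>u\<^bsub>i+1\<^esub>\<close>, and the one above it by \<open>u\<^sub>i\<close>, puts the factor \<open>u\<^sub>i\<close> in the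
  numerator. The source prints these numerators without it, and then the identity fails:
  for \<open>n = 2\<close> and \<open>q = 2\<close> the printed fraction is \<open>285 / 11\<close>, while the product is \<open>255\<close>.
\<close>

fun binary_cfrac_level :: "'a::field \<Rightarrow> nat \<Rightarrow> 'a \<times> 'a" where
  "binary_cfrac_level q 0 = (1, 1)"
| "binary_cfrac_level q (Suc 0) = (q ^ 1, 1 + q ^ 1)"
| "binary_cfrac_level q (Suc (Suc 0)) = ((1 + q ^ 1) * q ^ 2, q ^ 1 + q ^ 2 + q ^ 1 * q ^ 2)"
| "binary_cfrac_level q (Suc (Suc (Suc i))) =
     (q ^ (2 ^ i) * (1 + q ^ (2 ^ (i + 1))) * q ^ (2 ^ (i + 2)),
      q ^ (2 ^ (i + 1)) + q ^ (2 ^ (i + 2)) + q ^ (2 ^ (i + 1)) * q ^ (2 ^ (i + 2)))"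

text \<open>The innermost level is the one whose numerator contains \<open>q ^ (2 ^ n)\<close>, with index \<open>n + 1\<close>.\<close>

definition binary_cfrac :: "'a::field \<Rightarrow> nat \<Rightarrow> ('a \<times> 'a) list" where
  "binary_cfrac q n = map (binary_cfrac_level q) [0..<n + 2]"

text \<open>The indeterminate, as an element of the field of rational functions.\<close>

definition fract_X :: "'k::field poly fract" where
  "fract_X = Fract [:0, 1:] 1"

end

theory Submission
  imports Defs
begin

text \<open>
  Write \<open>u\<^sub>i = q ^ (2 ^ i)\<close> and \<open>Q\<^sub>m = (1 + u\<^sub>m) \<dots> (1 + u\<^sub>n)\<close>, so that the product in question
  is \<open>Q\<^sub>0\<close>.

  The closed form holds because \<open>u\<^bsub>i+1\<^esub> = u\<^sub>i\<^sup>2\<close>, hence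
  \<open>(1 - u\<^sub>i) (1 + u\<^sub>i) = 1 - u\<^bsub>i+1\<^esub>\<close> and the product telescopes
  (\<open>binary_tail_telescope\<close>).  The partition sum arises by multiplying the product out: every
  set of exponents contributes one monomial, and sets of exponents correspond to partitions
  into distinct powers of two (\<open>binary_product_eq_partition_sum\<close>).

  The continued fraction is evaluated from the inside, for \<open>q \<noteq> 0\<close>.  Its tail after the
  first \<open>m + 2\<close> levels is \<open>s (1 + u\<^sub>m) (Q\<^bsub>m+1\<^esub> - 1) / (Q\<^sub>m - 1)\<close>, where
  \<open>s\<close> is \<open>u\<^bsub>m-1\<^esub>\<close>, or \<open>1\<close> if \<open>m = 0\<close> (\<open>level_tail_eval\<close>).
  Up to \<open>s\<close> this is Euler's ratio of two consecutive remainders of the sum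
  \<open>1 + u\<^sub>0 + (1 + u\<^sub>0) u\<^sub>1 + \<dots> + (1 + u\<^sub>0) \<dots> (1 + u\<^bsub>n-1\<^esub>) u\<^sub>n\<close>: the
  partial sums are the products \<open>(1 + u\<^sub>0) \<dots> (1 + u\<^bsub>m-1\<^esub>)\<close>, so the remainder that is
  left at \<open>m\<close> is such a product times \<open>Q\<^sub>m - 1\<close>.  The first two levels, whose
  denominators come out as \<open>1 / Q\<^sub>0\<close> and \<open>u\<^sub>0 Q\<^sub>0 / (Q\<^sub>0 - 1)\<close>, then recover
  \<open>Q\<^sub>0\<close> itself.  All the denominators being explicit, the fraction makes sense exactly when
  \<open>Q\<^sub>0 \<noteq> 0\<close> and no \<open>Q\<^sub>m\<close> with \<open>m < n\<close> equals \<open>1\<close> (\<open>binary_cfrac_eval\<close>).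
  For the indeterminate these conditions follow from the telescoped form, since its powers with
  distinct exponents are distinct.
\<close>

section \<open>The telescoping product\<close>

definition binary_tail :: "'a::comm_ring_1 \<Rightarrow> nat \<Rightarrow> nat \<Rightarrow> 'a" where
  "binary_tail q n m = (\<Prod>i=m..n. 1 + q ^ (2 ^ i))"

lemma binary_tail_rec:
  "m \<le> n \<Longrightarrow> binary_tail q n m = (1 + q ^ (2 ^ m)) * binary_tail q n (Suc m)"
  unfolding binary_tail_def by (rule prod.atLeast_Suc_atMost)

lemma binary_tail_empty: "binary_tail q n (Suc n) = 1"
  by (simp add: binary_tail_def)

lemma binary_tail_telescope:
  assumes "m \<le> Suc n"
  shows "(1 - q ^ (2 ^ m)) * binary_tail q n m = 1 - q ^ (2 ^ Suc n)"
  using assms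
proof (induction m rule: inc_induct)
  case base
  show ?case by (simp add: binary_tail_empty)
next
  case (step m)
  have "(1 - q ^ (2 ^ m)) * (1 + q ^ (2 ^ m)) = 1 - q ^ (2 ^ Suc m)"
    by (simp add: algebra_simps flip: power_add mult_2)
  with step show ?case
    by (simp add: binary_tail_rec flip: mult.assoc)
qed

section \<open>Partitions into distinct powers of two\<close>

text \<open>
  A multiset without repeated elements is its underlying set, and \<open>i \<mapsto> 2 ^ i\<close> is injective;
  hence a partition into distinct powers of two is a set of exponents.
\<close>

lemma p2D_eq_card_exponent_sets:
  "p2D n k = card {B \<in> Pow {0..n}. (\<Sum>i\<in>B. 2 ^ i) = k}"
proof -
  let ?f = "\<lambda>B. mset_set ((\<lambda>i. 2 ^ i :: nat) ` B)"
  have inj: "inj_on (\<lambda>i. 2 ^ i :: nat) B" for B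
    by (auto intro: inj_onI)
  have "bij_betw ?f {B \<in> Pow {0..n}. (\<Sum>i\<in>B. 2 ^ i) = k} (distinct_binary_partitions n k)"
  proof (rule bij_betwI')
    fix A B assume A: "A \<in> {B \<in> Pow {0..n}. (\<Sum>i\<in>B. 2 ^ i) = k}"
      and B: "B \<in> {B \<in> Pow {0..n}. (\<Sum>i\<in>B. 2 ^ i) = k}"
    have fin: "finite A" "finite B"
      using A B by (auto intro: finite_subset)
    show "?f A = ?f B \<longleftrightarrow> A = B"
      using fin by (simp add: mset_set_eq_iff inj_image_eq_iff[OF inj])
  next
    fix B assume B: "B \<in> {B \<in> Pow {0..n}. (\<Sum>i\<in>B. 2 ^ i) = k}"
    then have fin: "finite B" by (auto intro: finite_subset)
    have "sum_mset (?f B) = (\<Sum>i\<in>B. 2 ^ i)"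
      using sum.reindex[OF inj, of id] by (simp add: sum_unfold_sum_mset)
    then show "?f B \<in> distinct_binary_partitions n k"
      using B fin by (auto simp: distinct_binary_partitions_def count_mset_set')
  next
    fix M assume M: "M \<in> distinct_binary_partitions n k"
    define B where "B = {i. 2 ^ i \<in># M}"
    have sub: "B \<subseteq> {0..n}" and im: "(\<lambda>i. 2 ^ i) ` B = set_mset M"
      using M by (auto simp: B_def distinct_binary_partitions_def)
    have "M = mset_set (set_mset M)"
    proof (rule multiset_eqI)
      fix x
      have "count M x \<le> 1"
        using M by (simp add: distinct_binary_partitions_def)
      then show "count M x = count (mset_set (set_mset M)) x"
        using count_eq_zero_iff[of M x] by (cases "x \<in># M") (auto simp: le_Suc_eq)
    qed
    then have eq: "M = ?f B" by (simp add: im)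
    have "(\<Sum>i\<in>B. 2 ^ i) = sum_mset (?f B)"
      using sum.reindex[OF inj, of id] by (simp add: sum_unfold_sum_mset)
    also have "\<dots> = k"
      using M eq by (simp add: distinct_binary_partitions_def)
    finally show "\<exists>B\<in>{B \<in> Pow {0..n}. (\<Sum>i\<in>B. 2 ^ i) = k}. M = ?f B"
      using sub eq by blast
  qed
  then show ?thesis
    unfolding p2D_def by (simp add: bij_betw_same_card)
qed

lemma binary_product_eq_partition_sum:
  fixes q :: "'a::comm_ring_1"
  shows "(\<Prod>i=0..n. 1 + q ^ (2 ^ i)) = (\<Sum>k=0..2 ^ (n + 1) - 1. of_nat (p2D n k) * q ^ k)"
proof -
  let ?s = "\<lambda>B. \<Sum>i\<in>B. 2 ^ i :: nat"
  have bound: "?s B \<le> 2 ^ (n + 1) - 1" if "B \<subseteq> {0..n}" for B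
  proof -
    have "?s B \<le> ?s {0..n}" using that by (intro sum_mono2) auto
    also have "\<dots> = 2 ^ (n + 1) - 1"
      using mask_eq_sum_exp_nat[of "Suc n"] by (simp add: less_Suc_eq_le atLeast0AtMost atMost_def)
    finally show ?thesis .
  qed
  have "(\<Prod>i=0..n. 1 + q ^ (2 ^ i)) = (\<Prod>i=0..n. q ^ (2 ^ i) + 1)"
    by (simp add: add.commute)
  also have "\<dots> = (\<Sum>B\<in>Pow {0..n}. q ^ ?s B)"
    by (simp add: prod_add power_sum)
  also have "\<dots> = (\<Sum>k=0..2 ^ (n + 1) - 1. \<Sum>B\<in>{B \<in> Pow {0..n}. ?s B = k}. q ^ ?s B)"
    by (rule sum.group[symmetric]) (use bound in auto)
  also have "\<dots> = (\<Sum>k=0..2 ^ (n + 1) - 1. of_nat (p2D n k) * q ^ k)"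
    by (rule sum.cong) (simp_all add: p2D_eq_card_exponent_sets)
  finally show ?thesis .
qed

section \<open>The continued fraction\<close>

text \<open>
  From the third level on all levels have the same shape, provided that the factor \<open>u\<^bsub>m-1\<^esub>\<close>
  is read as \<open>1\<close> for \<open>m = 0\<close>.
\<close>

definition level_scale :: "'a::field \<Rightarrow> nat \<Rightarrow> 'a" where
  "level_scale q m = (case m of 0 \<Rightarrow> 1 | Suc i \<Rightarrow> q ^ (2 ^ i))"

lemma binary_cfrac_level_eq:
  "binary_cfrac_level q (Suc (Suc m)) =
     (level_scale q m * (1 + q ^ (2 ^ m)) * q ^ (2 ^ Suc m),
      q ^ (2 ^ m) + q ^ (2 ^ Suc m) + q ^ (2 ^ m) * q ^ (2 ^ Suc m))"
  by (cases m) (simp_all add: level_scale_def)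

definition level_tail :: "'a::field \<Rightarrow> nat \<Rightarrow> nat \<Rightarrow> ('a \<times> 'a) list" where
  "level_tail q n m = map (binary_cfrac_level q) [Suc (Suc m)..<n + 2]"

lemma level_tail_Nil: "level_tail q n n = []"
  by (simp add: level_tail_def)

lemma level_tail_Cons:
  "m < n \<Longrightarrow> level_tail q n m = binary_cfrac_level q (Suc (Suc m)) # level_tail q n (Suc m)"
  by (simp add: level_tail_def upt_conv_Cons del: binary_cfrac_level.simps upt_Suc)

lemma binary_cfrac_eq:
  "binary_cfrac q n = (1, 1) # (q, 1 + q) # level_tail q n 0"
proof -
  have "[0..<n + 2] = 0 # Suc 0 # [Suc (Suc 0)..<n + 2]"
    by (simp add: upt_conv_Cons del: upt_Suc)
  then show ?thesis by (simp add: binary_cfrac_def level_tail_def)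
qed

text \<open>
  The induction runs from the empty tail outwards.  With \<open>Q\<^sub>m = binary_tail q n m\<close>, inserting
  the value of the inner tail turns the denominator of the next level into
  \<open>u\<^bsub>m+1\<^esub> (Q\<^sub>m - 1) / (Q\<^bsub>m+1\<^esub> - 1)\<close>, which settles both the value and
  the question whether the level is defined.
\<close>

lemma level_tail_eval:
  fixes q :: "'a::field"
  assumes "q \<noteq> 0" and "m \<le> n"
  shows "(cfrac_defined (level_tail q n m) \<longleftrightarrow> (\<forall>j\<in>{m..<n}. binary_tail q n j \<noteq> 1)) \<and>
    (cfrac_defined (level_tail q n m) \<longrightarrow>
       binary_tail q n m \<noteq> 1 \<and>
       cfrac (level_tail q n m) =
         level_scale q m * (1 + q ^ (2 ^ m)) * (binary_tail q n (Suc m) - 1)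
           / (binary_tail q n m - 1))"
  using \<open>m \<le> n\<close>
proof (induction m rule: inc_induct)
  case base
  show ?case
    using \<open>q \<noteq> 0\<close> by (simp add: level_tail_Nil binary_tail_rec binary_tail_empty)
next
  case (step m)
  define u v where "u = q ^ (2 ^ m)" and "v = q ^ (2 ^ Suc m)"
  define P Q R where "P = binary_tail q n m" and "Q = binary_tail q n (Suc m)"
    and "R = binary_tail q n (Suc (Suc m))"
  let ?t = "level_tail q n (Suc m)"
  have v: "v \<noteq> 0" using \<open>q \<noteq> 0\<close> by (simp add: v_def)
  have P: "P = (1 + u) * Q" and Q: "Q = (1 + v) * R"
    using step.hyps by (simp_all add: P_def Q_def R_def u_def v_def binary_tail_rec)
  have range: "{m..<n} = insert m {Suc m..<n}"
    using step.hyps by auto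
  have tail: "level_tail q n m =
      (level_scale q m * (1 + u) * v, u + v + u * v) # ?t"
    using step.hyps by (simp add: level_tail_Cons binary_cfrac_level_eq u_def v_def)
  have IH_def: "cfrac_defined ?t \<longleftrightarrow> (\<forall>j\<in>{Suc m..<n}. binary_tail q n j \<noteq> 1)"
    using step.IH by blast
  show ?case
  proof (cases "cfrac_defined ?t")
    case False
    then show ?thesis by (auto simp: tail range IH_def)
  next
    case True
    then have Q1: "Q - 1 \<noteq> 0" and val: "cfrac ?t = u * (1 + v) * (R - 1) / (Q - 1)"
      using step.IH by (simp_all add: level_scale_def u_def v_def Q_def R_def)
    have "(u + v + u * v) * (Q - 1) - u * (1 + v) * (R - 1) = v * (P - 1)"
      unfolding P Q by (simp add: algebra_simps)
    then have den: "u + v + u * v - cfrac ?t = v * (P - 1) / (Q - 1)"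
      using Q1 by (simp add: val diff_divide_eq_iff)
    have "u + v + u * v - cfrac ?t \<noteq> 0 \<longleftrightarrow> P \<noteq> 1"
      unfolding den using Q1 v by simp
    moreover have "cfrac (level_tail q n m) = level_scale q m * (1 + u) * (Q - 1) / (P - 1)"
      using v by (simp add: tail den)
    ultimately show ?thesis
      using True IH_def by (simp add: tail range flip: u_def P_def Q_def)
  qed
qed

lemma binary_cfrac_eval:
  fixes q :: "'a::field"
  assumes "q \<noteq> 0"
  shows "cfrac_defined (binary_cfrac q n) \<longleftrightarrow>
           binary_tail q n 0 \<noteq> 0 \<and> (\<forall>j<n. binary_tail q n j \<noteq> 1)"
    and "cfrac_defined (binary_cfrac q n) \<Longrightarrow> cfrac (binary_cfrac q n) = binary_tail q n 0"
proof -
  define P Q where "P = binary_tail q n 0" and "Q = binary_tail q n (Suc 0)"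
  let ?t = "level_tail q n 0"
  have P: "P = (1 + q) * Q"
    by (simp add: P_def Q_def binary_tail_rec)
  have t_def: "cfrac_defined ?t \<longleftrightarrow> (\<forall>j<n. binary_tail q n j \<noteq> 1)"
    using level_tail_eval[OF assms, of 0 n] by auto
  have eval: "(cfrac_defined (binary_cfrac q n) \<longleftrightarrow> P \<noteq> 0) \<and>
      (P \<noteq> 0 \<longrightarrow> cfrac (binary_cfrac q n) = P)" if "cfrac_defined ?t"
  proof -
    have P1: "P - 1 \<noteq> 0" and val: "cfrac ?t = (1 + q) * (Q - 1) / (P - 1)"
      using level_tail_eval[OF assms, of 0 n] that
      by (simp_all add: level_scale_def P_def Q_def)
    have "(1 + q) * (P - 1) - (1 + q) * (Q - 1) = q * P"
      unfolding P by (simp add: algebra_simps)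
    then have den: "1 + q - cfrac ?t = q * P / (P - 1)"
      using P1 by (simp add: val diff_divide_eq_iff)
    have "1 - q / (1 + q - cfrac ?t) = 1 / P" if "P \<noteq> 0"
      using assms P1 that by (simp add: den field_simps)
    then show ?thesis
      using \<open>cfrac_defined ?t\<close> P1 assms by (auto simp: binary_cfrac_eq den)
  qed
  show "cfrac_defined (binary_cfrac q n) \<longleftrightarrow>
      binary_tail q n 0 \<noteq> 0 \<and> (\<forall>j<n. binary_tail q n j \<noteq> 1)"
    using eval t_def by (auto simp: P_def binary_cfrac_eq)
  show "cfrac (binary_cfrac q n) = binary_tail q n 0" if "cfrac_defined (binary_cfrac q n)"
  proof -
    have "cfrac_defined ?t" using that by (simp add: binary_cfrac_eq)
    then show ?thesis using eval that by (simp add: P_def)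
  qed
qed

text \<open>
  At \<open>q = 0\<close> the third level has denominator \<open>0\<close>, so only the fraction with two levels
  makes sense there.
\<close>

lemma binary_cfrac_undefined_at_0:
  assumes "cfrac_defined (binary_cfrac (0::'a::field) n)"
  shows "n = 0"
proof (rule ccontr)
  assume "n \<noteq> 0"
  then have "0 < n" by simp
  have "cfrac (level_tail (0::'a) n 1) = 0"
  proof (cases "n = 1")
    case True
    then show ?thesis by (simp add: level_tail_Nil)
  next
    case False
    then have "1 < n" using \<open>0 < n\<close> by simp
    then show ?thesis by (simp add: level_tail_Cons binary_cfrac_level_eq)
  qed
  then show False
    using assms \<open>0 < n\<close> by (simp add: binary_cfrac_eq level_tail_Cons)
qed

lemma cfrac_binary_cfrac:
  fixes q :: "'a::field"
  assumes "cfrac_defined (binary_cfrac q n)"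
  shows "cfrac (binary_cfrac q n) = (\<Prod>i=0..n. 1 + q ^ (2 ^ i))"
proof (cases "q = 0")
  case True
  then have "n = 0" using assms binary_cfrac_undefined_at_0 by blast
  then show ?thesis using True by (simp add: binary_cfrac_eq level_tail_Nil)
next
  case False
  then show ?thesis using binary_cfrac_eval(2) assms by (simp add: binary_tail_def)
qed

section \<open>The indeterminate\<close>

lemma fract_X_power: "(fract_X :: 'k::field poly fract) ^ a = Fract (monom 1 a) 1"
proof (induction a)
  case 0
  show ?case by (simp add: One_fract_def)
next
  case (Suc a)
  then show ?case by (simp add: fract_X_def monom_Suc)
qed

lemma fract_X_power_eq_iff: "(fract_X :: 'k::field poly fract) ^ a = fract_X ^ b \<longleftrightarrow> a = b"
  by (simp add: fract_X_power eq_fract) (metis degree_monom_eq one_neq_zero)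

lemma cfrac_defined_fract_X: "cfrac_defined (binary_cfrac (fract_X :: 'k::field poly fract) n)"
proof -
  let ?q = "fract_X :: 'k poly fract"
  have "?q \<noteq> 0"
    by (simp add: fract_X_def Zero_fract_def eq_fract)
  moreover have "binary_tail ?q n 0 \<noteq> 0"
  proof
    assume "binary_tail ?q n 0 = 0"
    then have "?q ^ (2 ^ Suc n) = ?q ^ 0"
      using binary_tail_telescope[of 0 n ?q] by simp
    then show False unfolding fract_X_power_eq_iff by simp
  qed
  moreover have "binary_tail ?q n j \<noteq> 1" if "j < n" for j
  proof
    assume "binary_tail ?q n j = 1"
    then have "?q ^ (2 ^ j) = ?q ^ (2 ^ Suc n)"
      using binary_tail_telescope[of j n ?q] that by simp
    then have "j = Suc n" unfolding fract_X_power_eq_iff by (simp only: power_inject_exp one_less_numeral_iff semiring_norm)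
    then show False using that by simp
  qed
  ultimately show ?thesis by (simp add: binary_cfrac_eval(1))
qed

section \<open>The product, the partitions and the continued fraction\<close>

lemma binary_product_closed_form:
  fixes q :: "'a::field"
  assumes "1 - q \<noteq> 0"
  shows "(\<Prod>i=0..n. 1 + q ^ (2 ^ i)) = (1 - q ^ (2 ^ (n + 1))) / (1 - q)"
  using binary_tail_telescope[of 0 n q] assms
  by (simp add: binary_tail_def eq_divide_eq mult.commute)

theorem corollary2p6:
  fixes n :: nat
  shows
    "(let q = (fract_X :: 'k::field poly fract) in
        1 - q \<noteq> 0 \<and>
        cfrac_defined (binary_cfrac q n) \<and>
        (\<Prod>i=0..n. 1 + q ^ (2 ^ i)) = (1 - q ^ (2 ^ (n + 1))) / (1 - q) \<and>
        (1 - q ^ (2 ^ (n + 1))) / (1 - q) = (\<Sum>k=0..2 ^ (n + 1) - 1. of_nat (p2D n k) * q ^ k) \<and>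
        (\<Sum>k=0..2 ^ (n + 1) - 1. of_nat (p2D n k) * q ^ k) = cfrac (binary_cfrac q n))
     \<and>
     (\<forall>q :: 'a::field.
        (1 - q \<noteq> 0 \<longrightarrow>
          (\<Prod>i=0..n. 1 + q ^ (2 ^ i)) = (1 - q ^ (2 ^ (n + 1))) / (1 - q)) \<and>
        (\<Prod>i=0..n. 1 + q ^ (2 ^ i)) = (\<Sum>k=0..2 ^ (n + 1) - 1. of_nat (p2D n k) * q ^ k) \<and>
        (cfrac_defined (binary_cfrac q n) \<longrightarrow>
          (\<Sum>k=0..2 ^ (n + 1) - 1. of_nat (p2D n k) * q ^ k) = cfrac (binary_cfrac q n)))"
proof -
  have X: "1 - (fract_X :: 'k poly fract) \<noteq> 0"
    using fract_X_power_eq_iff[of 0 1, where 'k = 'k] by simp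
  show ?thesis
    unfolding Let_def
    using X cfrac_defined_fract_X[of n, where 'k = 'k]
      binary_product_closed_form[OF X, of n]
      binary_product_eq_partition_sum[of "fract_X :: 'k poly fract" n]
      cfrac_binary_cfrac[OF cfrac_defined_fract_X[of n, where 'k = 'k]]
      binary_product_closed_form[where 'a = 'a]
      binary_product_eq_partition_sum[where 'a = 'a]
      cfrac_binary_cfrac[where 'a = 'a]
    by metis
qed

end
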